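(* Let $\Lambda$ be a Frobenius $k$-algebra with nondegenerate multiplicative bilinear form $(-,-)$, let $\varphi$ be the corresponding Nakayama automorphism of $\Lambda$, and let $G$ be a finite group acting on $\Lambda$ by algebra automorphisms. If $(g(\lambda),g(\mu))=(\lambda,\mu)$ for all $g\in G$ and $\lambda,\mu\in\Lambda$, then $\varphi\otimes1:\lambda\otimes l\mapsto\varphi(\lambda)\otimes l$ is a Nakayama automorphism of the skew group algebra $\Lambda G$.
   Context: $k$ is a field; algebras are associative, unital, finite dimensional over $k$. The skew group algebra $\Lambda G$ is $\Lambda\otimes_k kG$ with multiplication $(\lambda\otimes g)(\mu\otimes h)=\lambda g(\mu)\otimes gh$. A bilinear form on an algebra $A$ is multiplicative if $(a,bc)=(ab,c)$ for all $a,b,c\in A$; an algebra is Frobenius if it admits a nondegenerate multiplicative bilinear form. Given such a form on $A$, there is a unique $k$-linear map $\varphi:A\to A$ with $(a,b)=(b,\varphi(a))$ for all $a,b\in A$; it is an algebra automorphism, and is called a Nakayama automorphism of $A$ (it depends on the form only up to inner automorphisms). If $\Lambda$ is Frobenius, $\Lambda G$ is Frobenius, a nondegenerate multiplicative form on it being $\langle\lambda\otimes l,\mu\otimes m\rangle=(\lambda,l(\mu))\,\delta$, where $\delta=1$ if $l=m^{-1}$ and $\delta=0$ otherwise ($\lambda,\mu\in\Lambda$, $l,m\in G$). *)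

theory Defs
  imports "Jordan_Normal_Form.Missing_VectorSpace" "HOL-Algebra.Group_Action"
begin

text \<open>
  The locale \<open>algebra\<close> of \<open>HOL-Algebra\<close> describes commutative algebras only, hence the
  following one.
\<close>

locale fd_algebra = vectorspace K A + ring A for K and A (structure) +
  assumes smult_mult_left:
      "\<lbrakk> c \<in> carrier K; x \<in> carrier A; y \<in> carrier A \<rbrakk> \<Longrightarrow>
       (c \<odot>\<^bsub>A\<^esub> x) \<otimes> y = c \<odot>\<^bsub>A\<^esub> (x \<otimes> y)"
    and smult_mult_right:
      "\<lbrakk> c \<in> carrier K; x \<in> carrier A; y \<in> carrier A \<rbrakk> \<Longrightarrow>
       x \<otimes> (c \<odot>\<^bsub>A\<^esub> y) = c \<odot>\<^bsub>A\<^esub> (x \<otimes> y)"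
    and finite_dimensional: "vectorspace.fin_dim K A"

locale bilinear_form = vectorspace K V for K and V and B +
  assumes form_closed: "\<lbrakk> x \<in> carrier V; y \<in> carrier V \<rbrakk> \<Longrightarrow> B x y \<in> carrier K"
    and form_add_left:
      "\<lbrakk> x \<in> carrier V; x' \<in> carrier V; y \<in> carrier V \<rbrakk> \<Longrightarrow>
       B (x \<oplus>\<^bsub>V\<^esub> x') y = B x y \<oplus>\<^bsub>K\<^esub> B x' y"
    and form_add_right:
      "\<lbrakk> x \<in> carrier V; y \<in> carrier V; y' \<in> carrier V \<rbrakk> \<Longrightarrow>
       B x (y \<oplus>\<^bsub>V\<^esub> y') = B x y \<oplus>\<^bsub>K\<^esub> B x y'"
    and form_smult_left:
      "\<lbrakk> c \<in> carrier K; x \<in> carrier V; y \<in> carrier V \<rbrakk> \<Longrightarrow>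
       B (c \<odot>\<^bsub>V\<^esub> x) y = c \<otimes>\<^bsub>K\<^esub> B x y"
    and form_smult_right:
      "\<lbrakk> c \<in> carrier K; x \<in> carrier V; y \<in> carrier V \<rbrakk> \<Longrightarrow>
       B x (c \<odot>\<^bsub>V\<^esub> y) = c \<otimes>\<^bsub>K\<^esub> B x y"

definition nondegenerate ::
  "('k, 'm) ring_scheme \<Rightarrow> ('k, 'v, 'n) module_scheme \<Rightarrow> ('v \<Rightarrow> 'v \<Rightarrow> 'k) \<Rightarrow> bool" where
  "nondegenerate K V B \<longleftrightarrow>
     (\<forall>x\<in>carrier V. (\<forall>y\<in>carrier V. B x y = \<zero>\<^bsub>K\<^esub>) \<longrightarrow> x = \<zero>\<^bsub>V\<^esub>) \<and>
     (\<forall>y\<in>carrier V. (\<forall>x\<in>carrier V. B x y = \<zero>\<^bsub>K\<^esub>) \<longrightarrow> y = \<zero>\<^bsub>V\<^esub>)"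

text \<open>A Frobenius algebra with a chosen form.\<close>

locale frobenius_form = fd_algebra K A + bilinear_form K A B for K and A (structure) and B +
  assumes nondegenerate: "nondegenerate K A B"
    and multiplicative:
      "\<lbrakk> a \<in> carrier A; b \<in> carrier A; c \<in> carrier A \<rbrakk> \<Longrightarrow> B a (b \<otimes> c) = B (a \<otimes> b) c"

definition nakayama_automorphism_of_form ::
  "('k, 'm) ring_scheme \<Rightarrow> ('k, 'a, 'n) module_scheme \<Rightarrow> ('a \<Rightarrow> 'a \<Rightarrow> 'k) \<Rightarrow> ('a \<Rightarrow> 'a) \<Rightarrow> bool" where
  "nakayama_automorphism_of_form K A B \<phi> \<longleftrightarrow>
     frobenius_form K A B \<and> linear_map K A A \<phi> \<and>
     (\<forall>a\<in>carrier A. \<forall>b\<in>carrier A. B a b = B b (\<phi> a))"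

definition nakayama_automorphism ::
  "('k, 'm) ring_scheme \<Rightarrow> ('k, 'a, 'n) module_scheme \<Rightarrow> ('a \<Rightarrow> 'a) \<Rightarrow> bool" where
  "nakayama_automorphism K A \<phi> \<longleftrightarrow> (\<exists>B. nakayama_automorphism_of_form K A B \<phi>)"

text \<open>
  Linearity and the identity relating \<open>\<phi>\<close> to the form determine \<open>\<phi>\<close> on the carrier and
  force it to be an injective algebra endomorphism, hence, in finite dimension, an automorphism.
\<close>

lemma (in frobenius_form) form_cancel_right:
  assumes uv: "u \<in> carrier A" "v \<in> carrier A"
    and eq: "\<And>c. c \<in> carrier A \<Longrightarrow> B c u = B c v"
  shows "u = v"
proof -
  let ?d = "u \<oplus>\<^bsub>A\<^esub> (\<ominus>\<^bsub>K\<^esub> \<one>\<^bsub>K\<^esub>) \<odot>\<^bsub>A\<^esub> v"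
  have mc: "(\<ominus>\<^bsub>K\<^esub> \<one>\<^bsub>K\<^esub>) \<odot>\<^bsub>A\<^esub> v \<in> carrier A"
    using uv by (simp add: smult_closed)
  have "B c ?d = \<zero>\<^bsub>K\<^esub>" if c: "c \<in> carrier A" for c
  proof -
    have "B c ?d = B c v \<oplus>\<^bsub>K\<^esub> (\<ominus>\<^bsub>K\<^esub> \<one>\<^bsub>K\<^esub>) \<otimes>\<^bsub>K\<^esub> B c v"
      using c uv mc eq by (simp add: form_add_right form_smult_right)
    also have "\<dots> = \<zero>\<^bsub>K\<^esub>"
      using form_closed[OF c uv(2)] by (simp add: R.l_minus R.r_neg)
    finally show ?thesis .
  qed
  hence "?d = \<zero>\<^bsub>A\<^esub>"
    using nondegenerate uv mc by (simp add: nondegenerate_def)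
  moreover have "(\<ominus>\<^bsub>K\<^esub> \<one>\<^bsub>K\<^esub>) \<odot>\<^bsub>A\<^esub> v = \<ominus>\<^bsub>A\<^esub> v"
    using uv by (simp add: smult_l_minus)
  ultimately show ?thesis
    using uv by (metis M.add.inv_closed M.add.inv_inv M.minus_equality)
qed

lemma nakayama_automorphism_of_form_unique:
  assumes "nakayama_automorphism_of_form K A B \<phi>" "nakayama_automorphism_of_form K A B \<psi>"
    and a: "a \<in> carrier A"
  shows "\<phi> a = \<psi> a"
proof -
  interpret frobenius_form K A B
    using assms by (simp add: nakayama_automorphism_of_form_def)
  interpret p: linear_map K A A \<phi>
    using assms by (simp add: nakayama_automorphism_of_form_def)
  interpret q: linear_map K A A \<psi>
    using assms by (simp add: nakayama_automorphism_of_form_def)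
  show ?thesis
  proof (rule form_cancel_right)
    fix c assume c: "c \<in> carrier A"
    show "B c (\<phi> a) = B c (\<psi> a)"
      using assms c by (metis nakayama_automorphism_of_form_def)
  qed (use a in auto)
qed

lemma nakayama_automorphism_of_form_ring_hom:
  assumes N: "nakayama_automorphism_of_form K A B \<phi>"
  shows "\<phi> \<in> ring_hom A A" and "inj_on \<phi> (carrier A)"
proof -
  interpret frobenius_form K A B
    using N by (simp add: nakayama_automorphism_of_form_def)
  interpret p: linear_map K A A \<phi>
    using N by (simp add: nakayama_automorphism_of_form_def)
  have N': "B x y = B y (\<phi> x)" if "x \<in> carrier A" "y \<in> carrier A" for x y
    using N that by (simp add: nakayama_automorphism_of_form_def)
  have pc: "\<phi> x \<in> carrier A" if "x \<in> carrier A" for x using that by auto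
  have mult: "\<phi> (a \<otimes>\<^bsub>A\<^esub> b) = \<phi> a \<otimes>\<^bsub>A\<^esub> \<phi> b"
    if ab: "a \<in> carrier A" "b \<in> carrier A" for a b
  proof (rule form_cancel_right)
    fix c assume c: "c \<in> carrier A"
    have "B c (\<phi> (a \<otimes>\<^bsub>A\<^esub> b)) = B (a \<otimes>\<^bsub>A\<^esub> b) c" using ab c by (intro N'[symmetric]) auto
    also have "\<dots> = B a (b \<otimes>\<^bsub>A\<^esub> c)" using multiplicative ab c by simp
    also have "\<dots> = B (b \<otimes>\<^bsub>A\<^esub> c) (\<phi> a)" using ab c by (intro N') auto
    also have "\<dots> = B b (c \<otimes>\<^bsub>A\<^esub> \<phi> a)" using multiplicative ab c pc by simp
    also have "\<dots> = B (c \<otimes>\<^bsub>A\<^esub> \<phi> a) (\<phi> b)" using ab c pc by (intro N') auto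
    also have "\<dots> = B c (\<phi> a \<otimes>\<^bsub>A\<^esub> \<phi> b)" using multiplicative ab c pc by simp
    finally show "B c (\<phi> (a \<otimes>\<^bsub>A\<^esub> b)) = B c (\<phi> a \<otimes>\<^bsub>A\<^esub> \<phi> b)" .
  qed (use ab pc in auto)
  have one: "\<phi> \<one>\<^bsub>A\<^esub> = \<one>\<^bsub>A\<^esub>"
  proof (rule form_cancel_right)
    fix c assume c: "c \<in> carrier A"
    have "B c (\<phi> \<one>\<^bsub>A\<^esub>) = B \<one>\<^bsub>A\<^esub> c" using c by (intro N'[symmetric]) auto
    also have "\<dots> = B \<one>\<^bsub>A\<^esub> (c \<otimes>\<^bsub>A\<^esub> \<one>\<^bsub>A\<^esub>)" using c by simp
    also have "\<dots> = B c \<one>\<^bsub>A\<^esub>" using multiplicative[of "\<one>\<^bsub>A\<^esub>" c "\<one>\<^bsub>A\<^esub>"] c by simp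
    finally show "B c (\<phi> \<one>\<^bsub>A\<^esub>) = B c \<one>\<^bsub>A\<^esub>" .
  qed (use pc in auto)
  show "\<phi> \<in> ring_hom A A"
    using mult one pc by (intro ring_hom_memI) auto
  have "x = \<zero>\<^bsub>A\<^esub>" if x: "x \<in> carrier A" "\<phi> x = \<zero>\<^bsub>A\<^esub>" for x
  proof -
    have "B x y = \<zero>\<^bsub>K\<^esub>" if y: "y \<in> carrier A" for y
    proof -
      have "B x y = B y (\<zero>\<^bsub>K\<^esub> \<odot>\<^bsub>A\<^esub> \<zero>\<^bsub>A\<^esub>)" using N'[OF x(1) y] x by (simp only: x(2)) simp
      also have "\<dots> = \<zero>\<^bsub>K\<^esub>"
        using y form_closed[of y "\<zero>\<^bsub>A\<^esub>"] by (subst form_smult_right) auto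
      finally show ?thesis .
    qed
    thus ?thesis using nondegenerate x by (simp add: nondegenerate_def)
  qed
  hence "p.kerT = {\<zero>\<^bsub>A\<^esub>}" by (auto simp: p.ker_def)
  thus "inj_on \<phi> (carrier A)" by (simp add: p.Ke0_iff_inj)
qed

text \<open>
  An action by algebra automorphisms. Bijectivity comes from the locale \<open>group_action\<close>, in which
  \<open>act g\<close> is a permutation of the carrier that is \<open>undefined\<close> outside of it.
\<close>

locale algebra_action = fd_algebra K A + group_action G "carrier A" act
  for K and A and G and act +
  assumes act_ring_hom: "g \<in> carrier G \<Longrightarrow> act g \<in> ring_hom A A"
    and act_linear: "g \<in> carrier G \<Longrightarrow> act g \<in> module_hom K A A"

text \<open>
  For finite \<open>G\<close> the elements of \<open>G\<close> form a basis of the group algebra \<open>kG\<close>, so every element of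
  \<open>\<Lambda> \<otimes>\<^sub>k kG\<close> is uniquely of the form \<open>\<Sum>g\<in>G. f g \<otimes> g\<close>. It is represented by its
  coefficient function \<open>f\<close>, \<open>undefined\<close> outside \<open>G\<close>. The product is the biadditive extension of
  \<open>(a \<otimes> l) (b \<otimes> m) = a l(b) \<otimes> lm\<close>.
\<close>

definition skew_group_algebra ::
  "('k, 'a, 'n) module_scheme \<Rightarrow> ('g, 'p) monoid_scheme \<Rightarrow> ('g \<Rightarrow> 'a \<Rightarrow> 'a)
     \<Rightarrow> ('k, 'g \<Rightarrow> 'a) module" where
  "skew_group_algebra \<Lambda> G act =
     \<lparr> carrier = carrier G \<rightarrow>\<^sub>E carrier \<Lambda>,
       mult = (\<lambda>f h. \<lambda>x\<in>carrier G.
         finsum \<Lambda> (\<lambda>(l, m). f l \<otimes>\<^bsub>\<Lambda>\<^esub> act l (h m))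
           {(l, m) \<in> carrier G \<times> carrier G. l \<otimes>\<^bsub>G\<^esub> m = x}),
       one = (\<lambda>x\<in>carrier G. if x = \<one>\<^bsub>G\<^esub> then \<one>\<^bsub>\<Lambda>\<^esub> else \<zero>\<^bsub>\<Lambda>\<^esub>),
       zero = (\<lambda>x\<in>carrier G. \<zero>\<^bsub>\<Lambda>\<^esub>),
       add = (\<lambda>f h. \<lambda>x\<in>carrier G. f x \<oplus>\<^bsub>\<Lambda>\<^esub> h x),
       smult = (\<lambda>c f. \<lambda>x\<in>carrier G. c \<odot>\<^bsub>\<Lambda>\<^esub> f x) \<rparr>"

text \<open>The element \<open>a \<otimes> l\<close>, for \<open>a\<close> in \<open>\<Lambda>\<close> and \<open>l\<close> in \<open>G\<close>.\<close>

definition pure_tensor ::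
  "('k, 'a, 'n) module_scheme \<Rightarrow> ('g, 'p) monoid_scheme \<Rightarrow> 'a \<Rightarrow> 'g \<Rightarrow> 'g \<Rightarrow> 'a" where
  "pure_tensor \<Lambda> G a l = (\<lambda>x\<in>carrier G. if x = l then a else \<zero>\<^bsub>\<Lambda>\<^esub>)"

text \<open>The map \<open>\<phi> \<otimes> 1\<close>.\<close>

definition tensor_id :: "('g, 'p) monoid_scheme \<Rightarrow> ('a \<Rightarrow> 'a) \<Rightarrow> ('g \<Rightarrow> 'a) \<Rightarrow> 'g \<Rightarrow> 'a" where
  "tensor_id G \<phi> f = (\<lambda>x\<in>carrier G. \<phi> (f x))"

lemma tensor_id_pure_tensor:
  assumes "linear_map K \<Lambda> \<Lambda> \<phi>"
  shows "tensor_id G \<phi> (pure_tensor \<Lambda> G a l) = pure_tensor \<Lambda> G (\<phi> a) l"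
proof -
  interpret linear_map K \<Lambda> \<Lambda> \<phi> by fact
  show ?thesis by (auto simp: tensor_id_def pure_tensor_def)
qed

lemma (in algebra_action) pure_tensor_mult:
  assumes fin: "finite (carrier G)" and lm: "l \<in> carrier G" "m \<in> carrier G"
    and ab: "a \<in> carrier A" "b \<in> carrier A"
  shows "pure_tensor A G a l \<otimes>\<^bsub>skew_group_algebra A G act\<^esub> pure_tensor A G b m
       = pure_tensor A G (a \<otimes>\<^bsub>A\<^esub> act l b) (l \<otimes>\<^bsub>G\<^esub> m)"
proof -
  interpret G: group G using group_hom by (rule group_hom.axioms)
  have act0: "act g \<zero>\<^bsub>A\<^esub> = \<zero>\<^bsub>A\<^esub>" if "g \<in> carrier G" for g
    using ring_hom_zero[OF act_ring_hom[OF that] ring_axioms ring_axioms] .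
  have actc: "act g c \<in> carrier A" if "g \<in> carrier G" "c \<in> carrier A" for g c
    using ring_hom_closed[OF act_ring_hom] that by blast
  show ?thesis
  proof
    fix x
    show "(pure_tensor A G a l \<otimes>\<^bsub>skew_group_algebra A G act\<^esub> pure_tensor A G b m) x
        = pure_tensor A G (a \<otimes>\<^bsub>A\<^esub> act l b) (l \<otimes>\<^bsub>G\<^esub> m) x"
    proof (cases "x \<in> carrier G")
      case x: True
      let ?P = "{(l, m) \<in> carrier G \<times> carrier G. l \<otimes>\<^bsub>G\<^esub> m = x}"
      let ?c = "a \<otimes>\<^bsub>A\<^esub> act l b"
      have finP: "finite ?P"
        by (rule finite_subset[of _ "carrier G \<times> carrier G"]) (use fin in auto)
      have "finsum A (\<lambda>(l', m'). pure_tensor A G a l l' \<otimes>\<^bsub>A\<^esub> act l' (pure_tensor A G b m m')) ?P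
          = finsum A (\<lambda>p. if (l, m) = p then ?c else \<zero>\<^bsub>A\<^esub>) ?P"
        by (rule M.finsum_cong') (use lm ab act0 actc in \<open>auto simp: pure_tensor_def split: if_splits\<close>)
      also have "\<dots> = (if x = l \<otimes>\<^bsub>G\<^esub> m then ?c else \<zero>\<^bsub>A\<^esub>)"
      proof (cases "x = l \<otimes>\<^bsub>G\<^esub> m")
        case True
        thus ?thesis
          using M.finsum_singleton[of "(l, m)" ?P "\<lambda>_. ?c"] finP lm ab actc by auto
      next
        case False
        have "finsum A (\<lambda>p. if (l, m) = p then ?c else \<zero>\<^bsub>A\<^esub>) ?P = finsum A (\<lambda>_. \<zero>\<^bsub>A\<^esub>) ?P"
          by (rule M.finsum_cong') (use False in auto)
        thus ?thesis using False by (simp add: M.finsum_zero)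
      qed
      finally show ?thesis
        using x by (simp add: skew_group_algebra_def pure_tensor_def)
    qed (simp add: skew_group_algebra_def pure_tensor_def)
  qed
qed

lemma (in algebra_action) skew_group_algebra_abelian_group:
  "abelian_group (skew_group_algebra A G act)"
proof (rule abelian_groupI)
  let ?S = "skew_group_algebra A G act"
  have mem: "f x \<in> carrier A" if "f \<in> carrier ?S" "x \<in> carrier G" for f x
    using that by (auto simp: skew_group_algebra_def)
  show "f \<oplus>\<^bsub>?S\<^esub> h \<in> carrier ?S" if "f \<in> carrier ?S" "h \<in> carrier ?S" for f h
    using mem[OF that(1)] mem[OF that(2)] by (simp add: skew_group_algebra_def)
  show "\<zero>\<^bsub>?S\<^esub> \<in> carrier ?S" by (simp add: skew_group_algebra_def)
  show "(f \<oplus>\<^bsub>?S\<^esub> h) \<oplus>\<^bsub>?S\<^esub> k = f \<oplus>\<^bsub>?S\<^esub> (h \<oplus>\<^bsub>?S\<^esub> k)"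
    if "f \<in> carrier ?S" "h \<in> carrier ?S" "k \<in> carrier ?S" for f h k
    using mem[OF that(1)] mem[OF that(2)] mem[OF that(3)]
    by (auto simp: skew_group_algebra_def M.a_assoc intro!: restrict_ext)
  show "f \<oplus>\<^bsub>?S\<^esub> h = h \<oplus>\<^bsub>?S\<^esub> f" if "f \<in> carrier ?S" "h \<in> carrier ?S" for f h
    using mem[OF that(1)] mem[OF that(2)]
    by (auto simp: skew_group_algebra_def M.a_comm intro!: restrict_ext)
  show "\<zero>\<^bsub>?S\<^esub> \<oplus>\<^bsub>?S\<^esub> f = f" if f: "f \<in> carrier ?S" for f
  proof -
    have "\<zero>\<^bsub>?S\<^esub> \<oplus>\<^bsub>?S\<^esub> f = restrict f (carrier G)"
      using mem[OF f] by (simp add: skew_group_algebra_def cong: restrict_cong)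
    also have "\<dots> = f"
      using f by (simp add: skew_group_algebra_def PiE_restrict)
    finally show ?thesis .
  qed
  show "\<exists>h\<in>carrier ?S. h \<oplus>\<^bsub>?S\<^esub> f = \<zero>\<^bsub>?S\<^esub>" if f: "f \<in> carrier ?S" for f
  proof
    show "(\<lambda>x\<in>carrier G. \<ominus>\<^bsub>A\<^esub> f x) \<oplus>\<^bsub>?S\<^esub> f = \<zero>\<^bsub>?S\<^esub>"
      using mem[OF f] by (simp add: skew_group_algebra_def M.l_neg cong: restrict_cong)
    show "(\<lambda>x\<in>carrier G. \<ominus>\<^bsub>A\<^esub> f x) \<in> carrier ?S"
      using mem[OF f] by (simp add: skew_group_algebra_def)
  qed
qed

lemma (in algebra_action) pure_tensor_expansion:
  assumes fin: "finite (carrier G)" and f: "f \<in> carrier (skew_group_algebra A G act)"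
  shows "f = (\<Oplus>\<^bsub>skew_group_algebra A G act\<^esub>g\<in>carrier G. pure_tensor A G (f g) g)"
proof -
  let ?S = "skew_group_algebra A G act"
  interpret S: abelian_group ?S by (rule skew_group_algebra_abelian_group)
  have fc: "f g \<in> carrier A" if "g \<in> carrier G" for g
    using f that by (auto simp: skew_group_algebra_def)
  have pt: "(\<lambda>g. pure_tensor A G (f g) g) \<in> X \<rightarrow> carrier ?S" if "X \<subseteq> carrier G" for X
    using fc that by (auto simp: skew_group_algebra_def pure_tensor_def)
  have "(\<Oplus>\<^bsub>?S\<^esub>g\<in>X. pure_tensor A G (f g) g)
      = (\<lambda>x\<in>carrier G. if x \<in> X then f x else \<zero>\<^bsub>A\<^esub>)"
    if "finite X" "X \<subseteq> carrier G" for X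
    using that
  proof (induction X)
    case empty
    show ?case unfolding S.finsum_empty by (simp add: skew_group_algebra_def)
  next
    case (insert g X)
    have "(\<Oplus>\<^bsub>?S\<^esub>g\<in>insert g X. pure_tensor A G (f g) g)
        = pure_tensor A G (f g) g \<oplus>\<^bsub>?S\<^esub> (\<Oplus>\<^bsub>?S\<^esub>g\<in>X. pure_tensor A G (f g) g)"
      using insert pt[of "insert g X"] pt[of X] by (intro S.finsum_insert) auto
    also have "\<dots> = pure_tensor A G (f g) g \<oplus>\<^bsub>?S\<^esub>
        (\<lambda>x\<in>carrier G. if x \<in> X then f x else \<zero>\<^bsub>A\<^esub>)"
      using insert.prems by (subst insert.IH) auto
    also have "\<dots> = (\<lambda>x\<in>carrier G. if x \<in> insert g X then f x else \<zero>\<^bsub>A\<^esub>)"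
      using insert.hyps insert.prems fc
      by (auto simp: skew_group_algebra_def pure_tensor_def intro!: restrict_ext)
    finally show ?case .
  qed
  from this[OF fin subset_refl] have "(\<Oplus>\<^bsub>?S\<^esub>g\<in>carrier G. pure_tensor A G (f g) g)
      = restrict f (carrier G)" by (simp cong: restrict_cong)
  moreover have "restrict f (carrier G) = f"
    using f by (simp add: skew_group_algebra_def PiE_restrict)
  ultimately show ?thesis by (rule trans[THEN sym])
qed

end

theory Submission
  imports Defs
begin

text \<open>
  The form on the skew group algebra is \<open>\<langle>f, h\<rangle> = ((f h)(1), 1)\<close>, where \<open>f h\<close> is the product in
  \<open>\<Lambda>G\<close> and \<open>(f h)(1)\<close> its coefficient at the identity of \<open>G\<close>. It agrees with the form of the paper
  on pure tensors, because \<open>(a b, 1) = (a, b)\<close>, and its multiplicativity is the associativity of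
  \<open>\<Lambda>G\<close>. Written out, it is \<open>\<Sum>\<^sub>l (f l, l(h(l\<^sup>-\<^sup>1)))\<close>, and
  \<open>(f l, l(h(l\<^sup>-\<^sup>1))) = (l(h(l\<^sup>-\<^sup>1)), \<phi>(f l)) = (h(l\<^sup>-\<^sup>1), l\<^sup>-\<^sup>1(\<phi>(f l)))\<close> by invariance.
\<close>

section \<open>Additive maps, submodules and finite sums\<close>

text \<open>Induction on \<open>X\<close>, with \<open>t\<close> sending zero to zero. This also
  settles infinite \<open>X\<close>, where both sums are zero by convention. It serves twice: for
  \<open>act g\<close>, and for the functional sending \<open>a\<close> to
  \<open>B a \<one>\<close>.\<close>

lemma finsum_additive:
  assumes "abelian_group A" "abelian_group C"
    and t: "t \<in> carrier A \<rightarrow> carrier C"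
    and add: "\<And>x y. \<lbrakk> x \<in> carrier A; y \<in> carrier A \<rbrakk> \<Longrightarrow> t (x \<oplus>\<^bsub>A\<^esub> y) = t x \<oplus>\<^bsub>C\<^esub> t y"
    and f: "f \<in> X \<rightarrow> carrier A"
  shows "t (finsum A f X) = finsum C (\<lambda>x. t (f x)) X"
proof -
  interpret A: abelian_group A by fact
  interpret C: abelian_group C by fact
  have tc: "t x \<in> carrier C" if "x \<in> carrier A" for x
    using t that by auto
  have zero: "t \<zero>\<^bsub>A\<^esub> = \<zero>\<^bsub>C\<^esub>"
    using add[of "\<zero>\<^bsub>A\<^esub>" "\<zero>\<^bsub>A\<^esub>"] tc[of "\<zero>\<^bsub>A\<^esub>"] by (simp add: C.add.r_cancel_one')
  show ?thesis
    using f
  proof (induction X rule: infinite_finite_induct)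
    case (insert x X)
    have "t (finsum A f (insert x X)) = t (f x) \<oplus>\<^bsub>C\<^esub> t (finsum A f X)"
      using insert by (simp add: add Pi_def)
    also have "\<dots> = finsum C (\<lambda>x. t (f x)) (insert x X)"
      using insert by (simp add: tc Pi_def)
    finally show ?case .
  qed (simp_all add: zero A.finsum_infinite C.finsum_infinite)
qed

lemma (in module) finsum_in_submodule:
  assumes "submodule R N M" "f \<in> X \<rightarrow> N"
  shows "finsum M f X \<in> N"
proof -
  interpret N: submodule R N M by fact
  show ?thesis
    using assms(2)
  proof (induction X rule: infinite_finite_induct)
    case (insert x X)
    hence "f \<in> X \<rightarrow> carrier M" "f x \<in> carrier M" using N.subset by auto
    with insert show ?case by simp
  qed (simp_all add: finsum_infinite)
qed

text \<open>Used to show that a linear map sends a whole space into a submodule once it sends a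
  spanning set there.\<close>

lemma (in mod_hom) vimage_is_submodule:
  assumes "submodule R N' N"
  shows "submodule R {x \<in> carrier M. f x \<in> N'} M"
proof -
  interpret N': submodule R N' N by fact
  have "f \<zero>\<^bsub>M\<^esub> = \<zero>\<^bsub>N\<^esub>"
    using f_smult[of "\<zero>\<^bsub>R\<^esub>" "\<zero>\<^bsub>M\<^esub>"] by simp
  thus ?thesis
    by unfold_locales auto
qed

section \<open>Coefficientwise calculus in the skew group algebra of a finite group\<close>

text \<open>Finiteness of \<open>G\<close> makes the sums over \<open>carrier G\<close> genuine;
  over an infinite index set \<open>finsum\<close> is zero by convention.\<close>

locale finite_algebra_action = algebra_action K A G act
  for K and A (structure) and G and act +
  assumes finite_group: "finite (carrier G)"
begin

sublocale G: group G
  using group_hom by (rule group_hom.axioms)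

abbreviation skew where "skew \<equiv> skew_group_algebra A G act"

lemma act_closed [simp]: "\<lbrakk> g \<in> carrier G; a \<in> carrier A \<rbrakk> \<Longrightarrow> act g a \<in> carrier A"
  by (rule ring_hom_closed[OF act_ring_hom])

lemma act_mult: "\<lbrakk> g \<in> carrier G; a \<in> carrier A; b \<in> carrier A \<rbrakk> \<Longrightarrow>
    act g (a \<otimes> b) = act g a \<otimes> act g b"
  by (rule ring_hom_mult[OF act_ring_hom])

lemma act_add: "\<lbrakk> g \<in> carrier G; a \<in> carrier A; b \<in> carrier A \<rbrakk> \<Longrightarrow>
    act g (a \<oplus> b) = act g a \<oplus> act g b"
  by (rule ring_hom_add[OF act_ring_hom])

lemma act_one [simp]: "g \<in> carrier G \<Longrightarrow> act g \<one> = \<one>"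
  by (rule ring_hom_one[OF act_ring_hom])

lemma act_zero [simp]: "g \<in> carrier G \<Longrightarrow> act g \<zero> = \<zero>"
  by (rule ring_hom_zero[OF act_ring_hom]) unfold_locales

lemma act_smult: "\<lbrakk> g \<in> carrier G; c \<in> carrier K; a \<in> carrier A \<rbrakk> \<Longrightarrow>
    act g (c \<odot>\<^bsub>A\<^esub> a) = c \<odot>\<^bsub>A\<^esub> act g a"
  by (rule module_hom_smult[OF act_linear])

lemma act_id: "a \<in> carrier A \<Longrightarrow> act \<one>\<^bsub>G\<^esub> a = a"
  by (simp add: id_eq_one[symmetric])

lemma act_finsum:
  assumes "g \<in> carrier G" "f \<in> X \<rightarrow> carrier A"
  shows "act g (finsum A f X) = finsum A (\<lambda>x. act g (f x)) X"
  using assms by (intro finsum_additive) (auto simp: act_add M.abelian_group_axioms)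

lemma skew_coeff_closed [simp]: "\<lbrakk> f \<in> carrier skew; x \<in> carrier G \<rbrakk> \<Longrightarrow> f x \<in> carrier A"
  by (auto simp: skew_group_algebra_def)

text \<open>Elements of the carrier are \<open>undefined\<close> off \<open>carrier G\<close>, so
  their coefficients on \<open>G\<close> determine them.\<close>

lemma skew_eqI:
  assumes "f \<in> carrier skew" "h \<in> carrier skew" "\<And>x. x \<in> carrier G \<Longrightarrow> f x = h x"
  shows "f = h"
  using assms by (auto simp: skew_group_algebra_def intro: PiE_ext)

lemma skew_closedI:
  "(\<And>x. x \<in> carrier G \<Longrightarrow> f x \<in> carrier A) \<Longrightarrow> restrict f (carrier G) \<in> carrier skew"
  by (simp add: skew_group_algebra_def)

lemma skew_add_apply: "x \<in> carrier G \<Longrightarrow> (f \<oplus>\<^bsub>skew\<^esub> h) x = f x \<oplus> h x"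
  and skew_smult_apply: "x \<in> carrier G \<Longrightarrow> (c \<odot>\<^bsub>skew\<^esub> f) x = c \<odot>\<^bsub>A\<^esub> f x"
  and skew_zero_apply: "x \<in> carrier G \<Longrightarrow> \<zero>\<^bsub>skew\<^esub> x = \<zero>"
  and skew_one_apply: "x \<in> carrier G \<Longrightarrow> \<one>\<^bsub>skew\<^esub> x = (if x = \<one>\<^bsub>G\<^esub> then \<one> else \<zero>)"
  by (simp_all add: skew_group_algebra_def)

lemma pure_tensor_apply: "x \<in> carrier G \<Longrightarrow> pure_tensor A G a l x = (if x = l then a else \<zero>)"
  by (simp add: pure_tensor_def)

lemma pure_tensor_closed [simp]: "a \<in> carrier A \<Longrightarrow> pure_tensor A G a l \<in> carrier skew"
  unfolding pure_tensor_def by (rule skew_closedI) auto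

text \<open>A pair \<open>(l, m)\<close> with product \<open>x\<close> is determined by
  \<open>l\<close>, since \<open>m\<close> must be the inverse of \<open>l\<close> times
  \<open>x\<close>. Reindexing by \<open>l\<close> gives a sum over the whole group, with an index
  set independent of \<open>x\<close>.\<close>

lemma skew_mult_apply:
  assumes f: "f \<in> carrier skew" and h: "h \<in> carrier skew" and x: "x \<in> carrier G"
  shows "(f \<otimes>\<^bsub>skew\<^esub> h) x = (\<Oplus>l\<in>carrier G. f l \<otimes> act l (h (inv\<^bsub>G\<^esub> l \<otimes>\<^bsub>G\<^esub> x)))"
proof -
  let ?p = "\<lambda>l. (l, inv\<^bsub>G\<^esub> l \<otimes>\<^bsub>G\<^esub> x)"
  let ?P = "{(l, m) \<in> carrier G \<times> carrier G. l \<otimes>\<^bsub>G\<^esub> m = x}"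
  have P: "?P = ?p ` carrier G"
    using x by (auto simp: G.m_assoc[symmetric] image_iff)
  have "(f \<otimes>\<^bsub>skew\<^esub> h) x = finsum A (\<lambda>(l, m). f l \<otimes> act l (h m)) (?p ` carrier G)"
    using x unfolding P[symmetric] by (simp add: skew_group_algebra_def)
  also have "\<dots> = finsum A (\<lambda>l. case ?p l of (l, m) \<Rightarrow> f l \<otimes> act l (h m)) (carrier G)"
    using f h x by (intro M.finsum_reindex) (auto simp: inj_on_def)
  finally show ?thesis by simp
qed

lemma skew_mult_closed:
  assumes "f \<in> carrier skew" "h \<in> carrier skew"
  shows "f \<otimes>\<^bsub>skew\<^esub> h \<in> carrier skew"
proof -
  have "f \<otimes>\<^bsub>skew\<^esub> h = restrict (f \<otimes>\<^bsub>skew\<^esub> h) (carrier G)"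
    by (simp add: skew_group_algebra_def)
  also have "\<dots> \<in> carrier skew"
    using assms by (intro skew_closedI) (auto simp: skew_mult_apply intro!: M.finsum_closed)
  finally show ?thesis .
qed

lemma skew_one_closed: "\<one>\<^bsub>skew\<^esub> \<in> carrier skew"
  by (auto simp: skew_group_algebra_def)

lemma skew_smult_closed: "\<lbrakk> c \<in> carrier K; f \<in> carrier skew \<rbrakk> \<Longrightarrow> c \<odot>\<^bsub>skew\<^esub> f \<in> carrier skew"
  by (auto simp: skew_group_algebra_def)

section \<open>Ring structure\<close>

text \<open>Both bracketings expand to double sums over \<open>G\<close>. They agree after
  exchanging the order of summation and translating the inner index by \<open>l\<close>, because
  \<open>act l\<close> is multiplicative and \<open>act\<close> turns products in \<open>G\<close>
  into composites.\<close>

lemma skew_mult_assoc: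
  assumes f: "f \<in> carrier skew" and h: "h \<in> carrier skew" and k: "k \<in> carrier skew"
  shows "(f \<otimes>\<^bsub>skew\<^esub> h) \<otimes>\<^bsub>skew\<^esub> k = f \<otimes>\<^bsub>skew\<^esub> (h \<otimes>\<^bsub>skew\<^esub> k)"
proof (rule skew_eqI)
  fix x assume x: "x \<in> carrier G"
  \<comment> \<open>Here \<open>l\<close> is the group component taken from \<open>f\<close>, and
    \<open>m\<close> is the product of the components taken from \<open>f\<close> and
    \<open>h\<close>.\<close>
  let ?s = "\<lambda>l m. f l \<otimes> act l (h (inv\<^bsub>G\<^esub> l \<otimes>\<^bsub>G\<^esub> m)) \<otimes> act m (k (inv\<^bsub>G\<^esub> m \<otimes>\<^bsub>G\<^esub> x))"
  have sc: "?s l m \<in> carrier A" if "l \<in> carrier G" "m \<in> carrier G" for l m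
    using that f h k x by simp
  have "((f \<otimes>\<^bsub>skew\<^esub> h) \<otimes>\<^bsub>skew\<^esub> k) x = (\<Oplus>m\<in>carrier G. \<Oplus>l\<in>carrier G. ?s l m)"
    unfolding skew_mult_apply[OF skew_mult_closed[OF f h] k x]
  proof (rule M.finsum_cong')
    fix m assume m: "m \<in> carrier G"
    show "(f \<otimes>\<^bsub>skew\<^esub> h) m \<otimes> act m (k (inv\<^bsub>G\<^esub> m \<otimes>\<^bsub>G\<^esub> x)) = (\<Oplus>l\<in>carrier G. ?s l m)"
      unfolding skew_mult_apply[OF f h m]
      using finite_group f h k x m by (intro finsum_ldistr) auto
  qed (use sc in \<open>auto intro!: M.finsum_closed\<close>)
  also have "\<dots> = (\<Oplus>l\<in>carrier G. \<Oplus>m\<in>carrier G. ?s l m)"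
    using finite_group sc by (intro finsum_finsum_swap) auto
  also have "\<dots> = (f \<otimes>\<^bsub>skew\<^esub> (h \<otimes>\<^bsub>skew\<^esub> k)) x"
    unfolding skew_mult_apply[OF f skew_mult_closed[OF h k] x]
  proof (rule M.finsum_cong')
    fix l assume l: "l \<in> carrier G"
    let ?y = "inv\<^bsub>G\<^esub> l \<otimes>\<^bsub>G\<^esub> x"
    have y: "?y \<in> carrier G" using l x by simp
    let ?r = "\<lambda>n. h n \<otimes> act n (k (inv\<^bsub>G\<^esub> n \<otimes>\<^bsub>G\<^esub> ?y))"
    have rc: "?r n \<in> carrier A" if "n \<in> carrier G" for n
      using that h k x l by simp
    \<comment> \<open>Left translation by \<open>l\<close> permutes \<open>G\<close>; the new index
      \<open>n\<close> is the component taken from \<open>h\<close>.\<close>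
    have "(\<Oplus>m\<in>carrier G. ?s l m) = (\<Oplus>m\<in>(\<lambda>n. l \<otimes>\<^bsub>G\<^esub> n) ` carrier G. ?s l m)"
      using l by (simp add: G.surj_const_mult)
    also have "\<dots> = (\<Oplus>n\<in>carrier G. ?s l (l \<otimes>\<^bsub>G\<^esub> n))"
      using l sc by (intro M.finsum_reindex) (auto simp: G.surj_const_mult G.inj_on_cmult)
    also have "\<dots> = (\<Oplus>n\<in>carrier G. f l \<otimes> act l (?r n))"
    proof (rule M.finsum_cong')
      fix n assume n: "n \<in> carrier G"
      have "inv\<^bsub>G\<^esub> l \<otimes>\<^bsub>G\<^esub> (l \<otimes>\<^bsub>G\<^esub> n) = n"
        using l n by (simp add: G.m_assoc[symmetric])
      moreover have "inv\<^bsub>G\<^esub> (l \<otimes>\<^bsub>G\<^esub> n) \<otimes>\<^bsub>G\<^esub> x = inv\<^bsub>G\<^esub> n \<otimes>\<^bsub>G\<^esub> ?y"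
        using l n x by (simp add: G.inv_mult_group G.m_assoc)
      ultimately show "?s l (l \<otimes>\<^bsub>G\<^esub> n) = f l \<otimes> act l (?r n)"
        using l n x f h k by (simp add: composition_rule act_mult m_assoc)
    qed (use l f rc in auto)
    also have "\<dots> = f l \<otimes> (\<Oplus>n\<in>carrier G. act l (?r n))"
      using finite_group l f rc by (intro finsum_rdistr[symmetric]) auto
    also have "\<dots> = f l \<otimes> act l (\<Oplus>n\<in>carrier G. ?r n)"
      using l rc by (subst act_finsum) auto
    also have "\<dots> = f l \<otimes> act l ((h \<otimes>\<^bsub>skew\<^esub> k) ?y)"
      unfolding skew_mult_apply[OF h k y] ..
    finally show "(\<Oplus>m\<in>carrier G. ?s l m) = f l \<otimes> act l ((h \<otimes>\<^bsub>skew\<^esub> k) ?y)" .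
  qed (use f x skew_mult_closed[OF h k] in auto)
  finally show "((f \<otimes>\<^bsub>skew\<^esub> h) \<otimes>\<^bsub>skew\<^esub> k) x = (f \<otimes>\<^bsub>skew\<^esub> (h \<otimes>\<^bsub>skew\<^esub> k)) x" .
qed (use assms skew_mult_closed in auto)

text \<open>Only the term at the identity of \<open>G\<close> survives, and the identity acts
  trivially on \<open>A\<close>.\<close>

lemma skew_l_one:
  assumes f: "f \<in> carrier skew"
  shows "\<one>\<^bsub>skew\<^esub> \<otimes>\<^bsub>skew\<^esub> f = f"
proof (rule skew_eqI)
  fix x assume x: "x \<in> carrier G"
  have "(\<one>\<^bsub>skew\<^esub> \<otimes>\<^bsub>skew\<^esub> f) x = (\<Oplus>l\<in>carrier G. if \<one>\<^bsub>G\<^esub> = l then f x else \<zero>)"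
    unfolding skew_mult_apply[OF skew_one_closed f x]
    using f x by (intro M.finsum_cong') (auto simp: skew_one_apply act_id)
  also have "\<dots> = f x"
    using finite_group f x by (intro M.finsum_singleton) auto
  finally show "(\<one>\<^bsub>skew\<^esub> \<otimes>\<^bsub>skew\<^esub> f) x = f x" .
qed (use f skew_mult_closed skew_one_closed in auto)

text \<open>Only the term \<open>l = x\<close> survives, and \<open>act l\<close> fixes the unit of
  \<open>A\<close>.\<close>

lemma skew_r_one:
  assumes f: "f \<in> carrier skew"
  shows "f \<otimes>\<^bsub>skew\<^esub> \<one>\<^bsub>skew\<^esub> = f"
proof (rule skew_eqI)
  fix x assume x: "x \<in> carrier G"
  have "inv\<^bsub>G\<^esub> l \<otimes>\<^bsub>G\<^esub> x = \<one>\<^bsub>G\<^esub> \<longleftrightarrow> x = l" if "l \<in> carrier G" for l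
    using that x G.inv_solve_left' by auto
  hence "(f \<otimes>\<^bsub>skew\<^esub> \<one>\<^bsub>skew\<^esub>) x = (\<Oplus>l\<in>carrier G. if x = l then f l else \<zero>)"
    unfolding skew_mult_apply[OF f skew_one_closed x]
    using f x by (intro M.finsum_cong') (auto simp: skew_one_apply)
  also have "\<dots> = f x"
    using finite_group f x by (intro M.finsum_singleton) auto
  finally show "(f \<otimes>\<^bsub>skew\<^esub> \<one>\<^bsub>skew\<^esub>) x = f x" .
qed (use f skew_mult_closed skew_one_closed in auto)

lemma skew_l_distr:
  assumes f: "f \<in> carrier skew" "f' \<in> carrier skew" and h: "h \<in> carrier skew"
  shows "(f \<oplus>\<^bsub>skew\<^esub> f') \<otimes>\<^bsub>skew\<^esub> h = f \<otimes>\<^bsub>skew\<^esub> h \<oplus>\<^bsub>skew\<^esub> f' \<otimes>\<^bsub>skew\<^esub> h"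
proof -
  interpret S: abelian_group skew by (rule skew_group_algebra_abelian_group)
  show ?thesis
  proof (rule skew_eqI)
    fix x assume x: "x \<in> carrier G"
    let ?s = "\<lambda>f l. f l \<otimes> act l (h (inv\<^bsub>G\<^esub> l \<otimes>\<^bsub>G\<^esub> x))"
    have "((f \<oplus>\<^bsub>skew\<^esub> f') \<otimes>\<^bsub>skew\<^esub> h) x = (\<Oplus>l\<in>carrier G. ?s f l \<oplus> ?s f' l)"
      unfolding skew_mult_apply[OF S.a_closed[OF f] h x]
      using f h x by (intro M.finsum_cong') (auto simp: skew_add_apply l_distr)
    also have "\<dots> = (\<Oplus>l\<in>carrier G. ?s f l) \<oplus> (\<Oplus>l\<in>carrier G. ?s f' l)"
      using f h x by (intro M.finsum_addf) auto
    finally show "((f \<oplus>\<^bsub>skew\<^esub> f') \<otimes>\<^bsub>skew\<^esub> h) x = (f \<otimes>\<^bsub>skew\<^esub> h \<oplus>\<^bsub>skew\<^esub> f' \<otimes>\<^bsub>skew\<^esub> h) x"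
      by (simp add: skew_add_apply skew_mult_apply f h x)
  qed (use assms skew_mult_closed in auto)
qed

lemma skew_r_distr:
  assumes f: "f \<in> carrier skew" and h: "h \<in> carrier skew" "h' \<in> carrier skew"
  shows "f \<otimes>\<^bsub>skew\<^esub> (h \<oplus>\<^bsub>skew\<^esub> h') = f \<otimes>\<^bsub>skew\<^esub> h \<oplus>\<^bsub>skew\<^esub> f \<otimes>\<^bsub>skew\<^esub> h'"
proof -
  interpret S: abelian_group skew by (rule skew_group_algebra_abelian_group)
  show ?thesis
  proof (rule skew_eqI)
    fix x assume x: "x \<in> carrier G"
    let ?s = "\<lambda>h l. f l \<otimes> act l (h (inv\<^bsub>G\<^esub> l \<otimes>\<^bsub>G\<^esub> x))"
    have "(f \<otimes>\<^bsub>skew\<^esub> (h \<oplus>\<^bsub>skew\<^esub> h')) x = (\<Oplus>l\<in>carrier G. ?s h l \<oplus> ?s h' l)"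
      unfolding skew_mult_apply[OF f S.a_closed[OF h] x]
      using f h x by (intro M.finsum_cong') (auto simp: skew_add_apply act_add r_distr)
    also have "\<dots> = (\<Oplus>l\<in>carrier G. ?s h l) \<oplus> (\<Oplus>l\<in>carrier G. ?s h' l)"
      using f h x by (intro M.finsum_addf) auto
    finally show "(f \<otimes>\<^bsub>skew\<^esub> (h \<oplus>\<^bsub>skew\<^esub> h')) x = (f \<otimes>\<^bsub>skew\<^esub> h \<oplus>\<^bsub>skew\<^esub> f \<otimes>\<^bsub>skew\<^esub> h') x"
      by (simp add: skew_add_apply skew_mult_apply f h x)
  qed (use assms skew_mult_closed in auto)
qed

lemma skew_ring: "ring skew"
proof (rule ringI)
  show "abelian_group skew" by (rule skew_group_algebra_abelian_group)
  show "Group.monoid skew"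
    by (rule Group.monoidI)
      (simp_all add: skew_mult_closed skew_one_closed skew_mult_assoc skew_l_one skew_r_one)
qed (simp_all add: skew_l_distr skew_r_distr)

section \<open>Linear structure and finite dimension\<close>

lemma skew_vectorspace: "vectorspace K skew"
proof -
  interpret S: ring skew by (rule skew_ring)
  have "module K skew"
  proof (rule moduleI)
    fix c d f h
    assume c: "c \<in> carrier K" "d \<in> carrier K" and f: "f \<in> carrier skew" "h \<in> carrier skew"
    show "(c \<oplus>\<^bsub>K\<^esub> d) \<odot>\<^bsub>skew\<^esub> f = c \<odot>\<^bsub>skew\<^esub> f \<oplus>\<^bsub>skew\<^esub> d \<odot>\<^bsub>skew\<^esub> f"
      using c f by (intro skew_eqI)
        (auto simp: skew_smult_closed skew_smult_apply skew_add_apply smult_l_distr)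
    show "c \<odot>\<^bsub>skew\<^esub> (f \<oplus>\<^bsub>skew\<^esub> h) = c \<odot>\<^bsub>skew\<^esub> f \<oplus>\<^bsub>skew\<^esub> c \<odot>\<^bsub>skew\<^esub> h"
      using c f by (intro skew_eqI)
        (auto simp: skew_smult_closed skew_smult_apply skew_add_apply smult_r_distr)
    show "(c \<otimes>\<^bsub>K\<^esub> d) \<odot>\<^bsub>skew\<^esub> f = c \<odot>\<^bsub>skew\<^esub> (d \<odot>\<^bsub>skew\<^esub> f)"
      using c f by (intro skew_eqI)
        (auto simp: skew_smult_closed skew_smult_apply smult_assoc1)
  next
    fix f assume "f \<in> carrier skew"
    thus "\<one>\<^bsub>K\<^esub> \<odot>\<^bsub>skew\<^esub> f = f"
      by (intro skew_eqI) (auto simp: skew_smult_closed skew_smult_apply)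
  qed (use skew_smult_closed in \<open>auto simp: R.is_cring S.is_abelian_group\<close>)
  thus ?thesis
    by (intro vectorspace.intro field_axioms)
qed

lemma skew_smult_mult_left:
  assumes c: "c \<in> carrier K" and f: "f \<in> carrier skew" and h: "h \<in> carrier skew"
  shows "(c \<odot>\<^bsub>skew\<^esub> f) \<otimes>\<^bsub>skew\<^esub> h = c \<odot>\<^bsub>skew\<^esub> (f \<otimes>\<^bsub>skew\<^esub> h)"
proof (rule skew_eqI)
  fix x assume x: "x \<in> carrier G"
  show "((c \<odot>\<^bsub>skew\<^esub> f) \<otimes>\<^bsub>skew\<^esub> h) x = (c \<odot>\<^bsub>skew\<^esub> (f \<otimes>\<^bsub>skew\<^esub> h)) x"
    unfolding skew_smult_apply[OF x] using c f h x finite_group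
    by (subst (1 2) skew_mult_apply, simp_all add: skew_smult_closed, subst finsum_smult_ldistr)
      (auto simp: skew_smult_apply smult_mult_left intro!: M.finsum_cong')
qed (use assms skew_mult_closed skew_smult_closed in auto)

text \<open>Unlike on the left, the scalar must first pass through \<open>act l\<close>; this is
  where the action has to be \<open>K\<close>-linear.\<close>

lemma skew_smult_mult_right:
  assumes c: "c \<in> carrier K" and f: "f \<in> carrier skew" and h: "h \<in> carrier skew"
  shows "f \<otimes>\<^bsub>skew\<^esub> (c \<odot>\<^bsub>skew\<^esub> h) = c \<odot>\<^bsub>skew\<^esub> (f \<otimes>\<^bsub>skew\<^esub> h)"
proof (rule skew_eqI)
  fix x assume x: "x \<in> carrier G"
  show "(f \<otimes>\<^bsub>skew\<^esub> (c \<odot>\<^bsub>skew\<^esub> h)) x = (c \<odot>\<^bsub>skew\<^esub> (f \<otimes>\<^bsub>skew\<^esub> h)) x"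
    unfolding skew_smult_apply[OF x] using c f h x finite_group
    by (subst (1 2) skew_mult_apply, simp_all add: skew_smult_closed, subst finsum_smult_ldistr)
      (auto simp: skew_smult_apply act_smult smult_mult_right intro!: M.finsum_cong')
qed (use assms skew_mult_closed skew_smult_closed in auto)

text \<open>Linearity in the first factor lets a spanning set of \<open>A\<close> produce one of
  \<open>skew\<close>.\<close>

lemma pure_tensor_mod_hom: "mod_hom K A skew (\<lambda>a. pure_tensor A G a l)"
proof -
  interpret S: vectorspace K skew by (rule skew_vectorspace)
  show ?thesis
  proof (unfold_locales, unfold module_hom_def, intro CollectI conjI allI impI)
    fix a b assume "a \<in> carrier A \<and> b \<in> carrier A"
    thus "pure_tensor A G (a \<oplus> b) l = pure_tensor A G a l \<oplus>\<^bsub>skew\<^esub> pure_tensor A G b l"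
      by (intro skew_eqI) (auto simp: skew_add_apply pure_tensor_apply)
  next
    fix c a assume "c \<in> carrier K \<and> a \<in> carrier A"
    thus "pure_tensor A G (c \<odot>\<^bsub>A\<^esub> a) l = c \<odot>\<^bsub>skew\<^esub> pure_tensor A G a l"
      by (intro skew_eqI) (auto simp: skew_smult_apply pure_tensor_apply)
  qed auto
qed

text \<open>If the finite set \<open>X\<close> spans \<open>A\<close>, the pure tensors of elements
  of \<open>X\<close> with elements of \<open>G\<close> span \<open>skew\<close>: they yield all
  pure tensors by linearity, and every element is a sum of pure tensors.\<close>

lemma skew_fin_dim: "vectorspace.fin_dim K skew"
proof -
  interpret S: vectorspace K skew by (rule skew_vectorspace)
  obtain X where X: "finite X" "X \<subseteq> carrier A" "span X = carrier A"
    using finite_dimensional by (auto simp: fin_dim_def)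
  let ?Y = "(\<lambda>(a, l). pure_tensor A G a l) ` (X \<times> carrier G)"
  have Y: "?Y \<subseteq> carrier skew" using X by auto
  have sub: "submodule K (S.span ?Y) skew"
    by (rule S.span_is_submodule[OF Y])
  have "carrier skew \<subseteq> S.span ?Y"
  proof
    fix f assume f: "f \<in> carrier skew"
    have "pure_tensor A G a l \<in> S.span ?Y" if l: "l \<in> carrier G" and a: "a \<in> carrier A" for a l
    proof -
      interpret p: mod_hom K A skew "\<lambda>a. pure_tensor A G a l" by (rule pure_tensor_mod_hom)
      \<comment> \<open>The right-hand side is the preimage of a submodule under a linear map, so
        containing \<open>X\<close> it contains the span of \<open>X\<close>, which is all of
        \<open>A\<close>.\<close>
      have "X \<subseteq> {a \<in> carrier A. pure_tensor A G a l \<in> S.span ?Y}"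
        using X(2) l S.in_own_span[OF Y] by auto
      from span_is_subset[OF this p.vimage_is_submodule[OF sub]] show ?thesis
        using a X(3) by auto
    qed
    hence "(\<Oplus>\<^bsub>skew\<^esub>g\<in>carrier G. pure_tensor A G (f g) g) \<in> S.span ?Y"
      using f by (intro S.finsum_in_submodule[OF sub]) auto
    thus "f \<in> S.span ?Y"
      using pure_tensor_expansion[OF finite_group f] by simp
  qed
  moreover have "S.span ?Y \<subseteq> carrier skew"
    by (rule S.span_is_subset2[OF Y])
  moreover have "finite ?Y" using X(1) finite_group by simp
  ultimately show ?thesis
    using Y unfolding S.fin_dim_def by blast
qed

lemma skew_fd_algebra: "fd_algebra K skew"
  by (intro fd_algebra.intro fd_algebra_axioms.intro skew_vectorspace skew_ring skew_fin_dim
      skew_smult_mult_left skew_smult_mult_right)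

section \<open>Linearity of \<open>\<phi> \<otimes> 1\<close>\<close>

lemma tensor_id_linear_map:
  assumes "linear_map K A A \<phi>"
  shows "linear_map K skew skew (tensor_id G \<phi>)"
proof -
  interpret p: linear_map K A A \<phi> by fact
  interpret S: vectorspace K skew by (rule skew_vectorspace)
  have cl: "tensor_id G \<phi> f \<in> carrier skew" if "f \<in> carrier skew" for f
    unfolding tensor_id_def using that by (intro skew_closedI) simp
  have ap: "tensor_id G \<phi> f x = \<phi> (f x)" if "x \<in> carrier G" for f x
    using that by (simp add: tensor_id_def)
  show ?thesis
  proof (unfold_locales, unfold module_hom_def, intro CollectI conjI allI impI)
    fix f h assume "f \<in> carrier skew \<and> h \<in> carrier skew"
    thus "tensor_id G \<phi> (f \<oplus>\<^bsub>skew\<^esub> h) = tensor_id G \<phi> f \<oplus>\<^bsub>skew\<^esub> tensor_id G \<phi> h"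
      by (intro skew_eqI) (auto simp: cl ap skew_add_apply)
  next
    fix c f assume "c \<in> carrier K \<and> f \<in> carrier skew"
    thus "tensor_id G \<phi> (c \<odot>\<^bsub>skew\<^esub> f) = c \<odot>\<^bsub>skew\<^esub> tensor_id G \<phi> f"
      by (intro skew_eqI) (auto simp: cl ap skew_smult_closed skew_smult_apply)
  qed (use cl in auto)
qed

end

section \<open>The bilinear form on the skew group algebra\<close>

locale frobenius_action = finite_algebra_action K A G act + frobenius_form K A B
  for K and A (structure) and G and act and B
begin

definition skew_form where
  "skew_form f h = B ((f \<otimes>\<^bsub>skew\<^esub> h) \<one>\<^bsub>G\<^esub>) \<one>"

lemma form_mult_one: "\<lbrakk> a \<in> carrier A; b \<in> carrier A \<rbrakk> \<Longrightarrow> B (a \<otimes> b) \<one> = B a b"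
  using multiplicative[of a b \<one>] by simp

text \<open>The additive functional sending \<open>a\<close> to \<open>B a \<one>\<close> moves
  inside the sum for the coefficient at the identity, and multiplicativity of \<open>B\<close> turns
  each term into a value of \<open>B\<close>. The explicit sum serves for nondegeneracy and for the
  Nakayama identity.\<close>

lemma skew_form_sum:
  assumes f: "f \<in> carrier skew" and h: "h \<in> carrier skew"
  shows "skew_form f h = (\<Oplus>\<^bsub>K\<^esub>l\<in>carrier G. B (f l) (act l (h (inv\<^bsub>G\<^esub> l))))"
proof -
  have "skew_form f h = B (\<Oplus>l\<in>carrier G. f l \<otimes> act l (h (inv\<^bsub>G\<^esub> l \<otimes>\<^bsub>G\<^esub> \<one>\<^bsub>G\<^esub>))) \<one>"
    unfolding skew_form_def by (simp add: skew_mult_apply[OF f h])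
  also have "\<dots> = (\<Oplus>\<^bsub>K\<^esub>l\<in>carrier G. B (f l \<otimes> act l (h (inv\<^bsub>G\<^esub> l \<otimes>\<^bsub>G\<^esub> \<one>\<^bsub>G\<^esub>))) \<one>)"
    using f h by (intro finsum_additive)
      (auto simp: form_add_left form_closed M.abelian_group_axioms R.abelian_group_axioms)
  also have "\<dots> = (\<Oplus>\<^bsub>K\<^esub>l\<in>carrier G. B (f l) (act l (h (inv\<^bsub>G\<^esub> l))))"
    using f h by (intro R.finsum_cong') (auto simp: form_mult_one form_closed)
  finally show ?thesis .
qed

lemma form_zero:
  assumes "a \<in> carrier A"
  shows "B \<zero> a = \<zero>\<^bsub>K\<^esub>" "B a \<zero> = \<zero>\<^bsub>K\<^esub>"
  using assms form_smult_left[of "\<zero>\<^bsub>K\<^esub>" \<zero> a] form_smult_right[of "\<zero>\<^bsub>K\<^esub>" a \<zero>]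
  by (simp_all add: form_closed)

text \<open>Pairing with a pure tensor isolates one coefficient of the other argument, which is how
  nondegeneracy is reduced to that of \<open>B\<close>.\<close>

lemma skew_form_pure_tensor_left:
  assumes l: "l \<in> carrier G" and a: "a \<in> carrier A" and h: "h \<in> carrier skew"
  shows "skew_form (pure_tensor A G a l) h = B a (act l (h (inv\<^bsub>G\<^esub> l)))"
proof -
  have "skew_form (pure_tensor A G a l) h
      = (\<Oplus>\<^bsub>K\<^esub>m\<in>carrier G. if l = m then B a (act m (h (inv\<^bsub>G\<^esub> m))) else \<zero>\<^bsub>K\<^esub>)"
    unfolding skew_form_sum[OF pure_tensor_closed[OF a] h]
    using assms by (intro R.finsum_cong') (auto simp: pure_tensor_apply form_zero form_closed)
  also have "\<dots> = B a (act l (h (inv\<^bsub>G\<^esub> l)))"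
    using assms finite_group by (intro R.finsum_singleton) (auto simp: form_closed)
  finally show ?thesis .
qed

text \<open>The group component is taken to be the inverse of \<open>l\<close> so that the surviving
  coefficient of \<open>f\<close> is the one at \<open>l\<close>.\<close>

lemma skew_form_pure_tensor_right:
  assumes l: "l \<in> carrier G" and b: "b \<in> carrier A" and f: "f \<in> carrier skew"
  shows "skew_form f (pure_tensor A G b (inv\<^bsub>G\<^esub> l)) = B (f l) (act l b)"
proof -
  have "skew_form f (pure_tensor A G b (inv\<^bsub>G\<^esub> l))
      = (\<Oplus>\<^bsub>K\<^esub>m\<in>carrier G. if l = m then B (f m) (act m b) else \<zero>\<^bsub>K\<^esub>)"
    unfolding skew_form_sum[OF f pure_tensor_closed[OF b]]
    using assms by (intro R.finsum_cong') (auto simp: pure_tensor_apply form_zero form_closed)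
  also have "\<dots> = B (f l) (act l b)"
    using assms finite_group by (intro R.finsum_singleton) (auto simp: form_closed)
  finally show ?thesis .
qed

text \<open>Testing against pure tensors reduces each half to the same half for \<open>B\<close>,
  one coefficient at a time. The left half needs \<open>act l\<close> to be surjective, the right
  half needs it to be injective.\<close>

lemma skew_form_nondegenerate: "nondegenerate K skew skew_form"
proof -
  have nd1: "a = \<zero>" if "a \<in> carrier A" "\<And>b. b \<in> carrier A \<Longrightarrow> B a b = \<zero>\<^bsub>K\<^esub>" for a
    using that nondegenerate by (simp add: nondegenerate_def)
  have nd2: "b = \<zero>" if "b \<in> carrier A" "\<And>a. a \<in> carrier A \<Longrightarrow> B a b = \<zero>\<^bsub>K\<^esub>" for b
    using that nondegenerate by (simp add: nondegenerate_def)
  interpret S: ring skew by (rule skew_ring)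
  show ?thesis
    unfolding nondegenerate_def
  proof (intro conjI ballI impI)
    fix f assume f: "f \<in> carrier skew" and z: "\<forall>h\<in>carrier skew. skew_form f h = \<zero>\<^bsub>K\<^esub>"
    have "f l = \<zero>" if l: "l \<in> carrier G" for l
    proof (rule nd1)
      fix b assume b: "b \<in> carrier A"
      \<comment> \<open>The test with a pure tensor controls \<open>B (f l)\<close> only on values
        of \<open>act l\<close>; by surjectivity these are all of \<open>A\<close>.\<close>
      hence "b \<in> act l ` carrier A" by (simp only: surj_prop[OF l])
      then obtain b' where b': "b' \<in> carrier A" "b = act l b'" by (rule imageE)
      have "B (f l) b = skew_form f (pure_tensor A G b' (inv\<^bsub>G\<^esub> l))"
        unfolding b'(2) by (rule skew_form_pure_tensor_right[OF l b'(1) f, symmetric])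
      also have "\<dots> = \<zero>\<^bsub>K\<^esub>" by (rule bspec[OF z pure_tensor_closed[OF b'(1)]])
      finally show "B (f l) b = \<zero>\<^bsub>K\<^esub>" .
    qed (use f l in simp)
    thus "f = \<zero>\<^bsub>skew\<^esub>"
      using f by (intro skew_eqI) (auto simp: skew_zero_apply)
  next
    fix h assume h: "h \<in> carrier skew" and z: "\<forall>f\<in>carrier skew. skew_form f h = \<zero>\<^bsub>K\<^esub>"
    have "h (inv\<^bsub>G\<^esub> l) = \<zero>" if l: "l \<in> carrier G" for l
    proof -
      have "act l (h (inv\<^bsub>G\<^esub> l)) = \<zero>"
      proof (rule nd2)
        fix a assume a: "a \<in> carrier A"
        have "B a (act l (h (inv\<^bsub>G\<^esub> l))) = skew_form (pure_tensor A G a l) h"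
          by (rule skew_form_pure_tensor_left[OF l a h, symmetric])
        also have "\<dots> = \<zero>\<^bsub>K\<^esub>" by (rule bspec[OF z pure_tensor_closed[OF a]])
        finally show "B a (act l (h (inv\<^bsub>G\<^esub> l))) = \<zero>\<^bsub>K\<^esub>" .
      qed (use h l in simp)
      also have "\<zero> = act l \<zero>" using l by simp
      finally show ?thesis
        by (rule inj_onD[OF inj_prop[OF l]]) (simp_all add: l h)
    qed
    \<comment> \<open>Every element of \<open>G\<close> is an inverse, so all coefficients of
      \<open>h\<close> are covered.\<close>
    hence "h l = \<zero>" if "l \<in> carrier G" for l
      using that G.inv_closed[OF that] G.inv_inv[OF that] by fastforce
    thus "h = \<zero>\<^bsub>skew\<^esub>"
      using h by (intro skew_eqI) (auto simp: skew_zero_apply)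
  qed
qed

text \<open>With the form defined through the product, bilinearity comes from the algebra laws of
  \<open>skew\<close> and linearity of \<open>B\<close> in its first argument.\<close>

lemma skew_frobenius_form: "frobenius_form K skew skew_form"
proof -
  interpret S: fd_algebra K skew by (rule skew_fd_algebra)
  show ?thesis
  proof (unfold_locales, goal_cases)
    case (1 x y)
    thus ?case by (simp add: skew_form_def form_closed)
  next
    case (2 x x' y)
    thus ?case by (simp add: skew_form_def skew_l_distr skew_add_apply form_add_left)
  next
    case (3 x y y')
    \<comment> \<open>The right argument of \<open>skew_form\<close> also enters through the left
      argument of \<open>B\<close>, hence \<open>form_add_left\<close> here and
      \<open>form_smult_left\<close> in the scalar case.\<close>
    thus ?case by (simp add: skew_form_def skew_r_distr skew_add_apply form_add_left)
  next
    case (4 c x y)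
    thus ?case by (simp add: skew_form_def skew_smult_mult_left skew_smult_apply form_smult_left)
  next
    case (5 c x y)
    thus ?case by (simp add: skew_form_def skew_smult_mult_right skew_smult_apply form_smult_left)
  next
    case 6
    show ?case by (rule skew_form_nondegenerate)
  next
    case (7 a b c)
    thus ?case by (simp add: skew_form_def skew_mult_assoc)
  qed
qed

section \<open>The Nakayama identity for \<open>\<phi> \<otimes> 1\<close>\<close>

lemma skew_nakayama_automorphism_of_form:
  assumes N: "nakayama_automorphism_of_form K A B \<phi>"
    and inv: "\<And>g a b. \<lbrakk> g \<in> carrier G; a \<in> carrier A; b \<in> carrier A \<rbrakk> \<Longrightarrow>
      B (act g a) (act g b) = B a b"
  shows "nakayama_automorphism_of_form K skew skew_form (tensor_id G \<phi>)"
proof -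
  have lin: "linear_map K A A \<phi>"
    using N by (simp add: nakayama_automorphism_of_form_def)
  interpret p: linear_map K A A \<phi> by (rule lin)
  interpret t: linear_map K skew skew "tensor_id G \<phi>" by (rule tensor_id_linear_map[OF lin])
  have sym: "B a b = B b (\<phi> a)" if "a \<in> carrier A" "b \<in> carrier A" for a b
    using N that by (simp add: nakayama_automorphism_of_form_def)
  have "skew_form f h = skew_form h (tensor_id G \<phi> f)"
    if f: "f \<in> carrier skew" and h: "h \<in> carrier skew" for f h
  proof -
    let ?i = "\<lambda>l. inv\<^bsub>G\<^esub> l"
    \<comment> \<open>This is the summand at \<open>m\<close> of the expansion of
      \<open>skew_form h (tensor_id G \<phi> f)\<close>. It will be matched with the summand of
      \<open>skew_form f h\<close> at the inverse of \<open>m\<close>, inversion being a permutation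
      of \<open>G\<close>.\<close>
    let ?r = "\<lambda>m. B (h m) (act m (\<phi> (f (?i m))))"
    have inj: "inj_on ?i (carrier G)" and im: "?i ` carrier G = carrier G"
      using G.inv_inj by (auto simp: image_iff) (metis G.inv_closed G.inv_inv)
    have "skew_form f h = (\<Oplus>\<^bsub>K\<^esub>l\<in>carrier G. ?r (?i l))"
      unfolding skew_form_sum[OF f h]
    proof (rule R.finsum_cong')
      fix l assume l: "l \<in> carrier G"
      have "B (f l) (act l (h (?i l))) = B (act l (h (?i l))) (\<phi> (f l))"
        using f h l by (intro sym) auto
      also have "\<dots> = B (act (?i l) (act l (h (?i l)))) (act (?i l) (\<phi> (f l)))"
        using f h l by (intro inv[symmetric]) auto
      also have "\<dots> = ?r (?i l)"
        \<comment> \<open>On the left \<open>act (?i l)\<close> cancels \<open>act l\<close>; on the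
          right the double inverse in \<open>?r (?i l)\<close> reduces to \<open>l\<close>.\<close>
        using f h l by (simp add: composition_rule[symmetric] act_id)
      finally show "B (f l) (act l (h (?i l))) = ?r (?i l)" .
    qed (use f h in \<open>auto simp: form_closed\<close>)
    also have "\<dots> = (\<Oplus>\<^bsub>K\<^esub>m\<in>?i ` carrier G. ?r m)"
      using f h inj by (intro R.finsum_reindex[symmetric]) (auto simp: form_closed im)
    also have "\<dots> = skew_form h (tensor_id G \<phi> f)"
      unfolding im skew_form_sum[OF h t.f_im[OF f]] using f h
      by (intro R.finsum_cong') (auto simp: tensor_id_def form_closed)
    finally show ?thesis .
  qed
  thus ?thesis
    unfolding nakayama_automorphism_of_form_def
    using skew_frobenius_form t.linear_map_axioms by blast
qed

end

theorem proposition2p5: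
  fixes K :: "('k, 'm) ring_scheme"
    and \<Lambda> :: "('k, 'a, 'n) module_scheme"
    and form :: "'a \<Rightarrow> 'a \<Rightarrow> 'k"
    and \<phi> :: "'a \<Rightarrow> 'a"
    and G :: "('g, 'p) monoid_scheme"
    and act :: "'g \<Rightarrow> 'a \<Rightarrow> 'a"
  assumes "frobenius_form K \<Lambda> form"
    and "nakayama_automorphism_of_form K \<Lambda> form \<phi>"
    and "finite (carrier G)"
    and "algebra_action K \<Lambda> G act"
    and "\<And>g a b. \<lbrakk> g \<in> carrier G; a \<in> carrier \<Lambda>; b \<in> carrier \<Lambda> \<rbrakk> \<Longrightarrow>
           form (act g a) (act g b) = form a b"
  shows "nakayama_automorphism K (skew_group_algebra \<Lambda> G act) (tensor_id G \<phi>)"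
proof -
  interpret frobenius_action K \<Lambda> G act form
    using assms(1,3,4)
    by (intro frobenius_action.intro finite_algebra_action.intro
        finite_algebra_action_axioms.intro)
  show ?thesis
    unfolding nakayama_automorphism_def
    \<comment> \<open>The witness for the existentially quantified form is
      \<open>skew_form\<close>.\<close>
    using skew_nakayama_automorphism_of_form[OF assms(2,5)] by blast
qed

end
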